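(* Let $\mathcal{S}_t=\{\boldsymbol{\xi}_{\underline{t}_i:\bar{t}_i}: i=1,\dots,N\}$ be a set of segments of the trajectory $\boldsymbol{\xi}$, available at time step $t$. For the $i$th segment $\boldsymbol{\xi}_{\underline{t}_i:\bar{t}_i}$ in the set, $1\le i\le N$, let $$W_i^t=\begin{cases} W_{i-1}^t+\boldsymbol{R}(\boldsymbol{\xi}_{\underline{t}_i:\bar{t}_i})^\prime\,\boldsymbol{R}(\boldsymbol{\xi}_{\underline{t}_i:\bar{t}_i}) & \text{if } \boldsymbol{\xi}_{\underline{t}_i:\bar{t}_i}\text{ is data effective},\\ W_{i-1}^t+\boldsymbol{0} & \text{otherwise,}\end{cases}$$ with $W_0^t=\boldsymbol{0}\in\mathbb{R}^{r\times r}$, so that $W_N^t$ is the matrix obtained from the effective data segments available at the current time step. Then the least-square estimate given these $N$ segments, $$\hat{\boldsymbol{\omega}}=\arg\min_{\boldsymbol{\omega}}\ \tfrac12\,\lVert \boldsymbol{R}(\mathcal{S}_t)\,\boldsymbol{\omega}\rVert^2\quad\text{subject to}\quad \boldsymbol{e}_1^\prime\boldsymbol{\omega}=1,$$ is $$\hat{\boldsymbol{\omega}}=\frac{(W_N^t)^{-1}\boldsymbol{e}_1}{\boldsymbol{e}_1^\prime (W_N^t)^{-1}\boldsymbol{e}_1}.$$ Here $\boldsymbol{e}_1=[1,0,\dots,0]^\prime\in\mathbb{R}^r$, and $\boldsymbol{R}(\mathcal{S}_t)$ is the vertical stack of the matrices $\boldsymbol{R}(\boldsymbol{\xi}_{\underline{t}_i:\bar{t}_i})$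 over all $i\in\{1,\dots,N\}$ for which $\boldsymbol{\xi}_{\underline{t}_i:\bar{t}_i}$ is data effective.
   Context: Prime denotes transpose and $\lVert\cdot\rVert$ is the $l_2$ norm. System and data. The dynamics are $\boldsymbol{x}_{t+1}=\boldsymbol{f}(\boldsymbol{x}_t,\boldsymbol{u}_{t+1})$, $\boldsymbol{x}_0\in\mathbb{R}^n$, with $\boldsymbol{f}:\mathbb{R}^n\times\mathbb{R}^m\to\mathbb{R}^n$ differentiable, state $\boldsymbol{x}_t\in\mathbb{R}^n$ and input $\boldsymbol{u}_t\in\mathbb{R}^m$. Let $\boldsymbol{\phi}:\mathbb{R}^n\times\mathbb{R}^m\to\mathbb{R}^r$ be a vector of specified differentiable features. The trajectory $\boldsymbol{\xi}=\{(\boldsymbol{x}_t^*,\boldsymbol{u}_t^* ): t=1,\dots,T\}$ ($T$ may be arbitrarily large or infinite) is supposed to be the result of optimizing (minimizing), subject to the dynamics, the objective $\sum_{t=1}^T\boldsymbol{\omega}^\prime\boldsymbol{\phi}(\boldsymbol{x}_t,\boldsymbol{u}_t)$, where $\boldsymbol{\omega}\in\mathbb{R}^r$ is an unknown weight vector, scaled without loss of generality so that its first entry is 1. A segment $\boldsymbol{\xi}_{\underline{t}:\bar{t}}\subseteq\boldsymbol{\xi}$, $1\le\underline{t}\le\bar{t}\le T$, is the part of $\boldsymbol{\xi}$ with time indices $\underline{t},\dots,\bar{t}$; a segment may be a single time instant, and different segments may overlap. The least-squares formulation is used because, in implementation, observation noise and/or sub-optimality exist. Jacobians along the trajectory. $\frac{\partial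 \boldsymbol{f}^\prime}{\partial \boldsymbol{x}_t^*}\in\mathbb{R}^{n\times n}$ is the transpose of the Jacobian of $\boldsymbol{f}$ with respect to its state argument, evaluated at $(\boldsymbol{x}_t^*,\boldsymbol{u}_{t+1}^* )$ (if $t=T<\infty$, $\boldsymbol{u}_{T+1}^*$ is some fixed vector in $\mathbb{R}^m$). $\frac{\partial \boldsymbol{f}^\prime}{\partial \boldsymbol{u}_t^*}\in\mathbb{R}^{m\times n}$ is the transpose of the Jacobian of $\boldsymbol{f}$ with respect to its input argument, evaluated at $(\boldsymbol{x}_{t-1}^*,\boldsymbol{u}_t^* )$, with $\boldsymbol{x}_0^*=\boldsymbol{x}_0$. $\frac{\partial \boldsymbol{\phi}^\prime}{\partial \boldsymbol{x}_t^*}\in\mathbb{R}^{n\times r}$ and $\frac{\partial \boldsymbol{\phi}^\prime}{\partial \boldsymbol{u}_t^*}\in\mathbb{R}^{m\times r}$ are the transposes of the Jacobians of $\boldsymbol{\phi}$ with respect to state and input, evaluated at $(\boldsymbol{x}_t^*,\boldsymbol{u}_t^* )$. Matrices of a segment. For a segment $\boldsymbol{\xi}_{\underline{t}:\bar{t}}$ of length $L=\bar{t}-\underline{t}+1$ define: - $\boldsymbol{A}\in\mathbb{R}^{nL\times nL}$: the block matrix with identity blocks on the diagonal, blocks $-\frac{\partial \boldsymbol{f}^\prime}{\partial \boldsymbol{x}_{\underline{t}}^*},\dots,-\frac{\partial \boldsymbol{f}^\prime}{\partial \boldsymbol{x}_{\bar{t}-1}^*}$ (in this order) on the first block superdiagonal,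 and zero elsewhere (so $\boldsymbol{A}$ is nonsingular); - $\boldsymbol{B}\in\mathbb{R}^{mL\times nL}$: the block diagonal matrix with diagonal blocks $\frac{\partial \boldsymbol{f}^\prime}{\partial \boldsymbol{u}_{\underline{t}}^*},\dots,\frac{\partial \boldsymbol{f}^\prime}{\partial \boldsymbol{u}_{\bar{t}}^*}$; - $\boldsymbol{M}\in\mathbb{R}^{nL\times r}$: the vertical stack of $\frac{\partial \boldsymbol{\phi}^\prime}{\partial \boldsymbol{x}_{s}^*}$, $s=\underline{t},\dots,\bar{t}$; - $\boldsymbol{N}\in\mathbb{R}^{mL\times r}$: the vertical stack of $\frac{\partial \boldsymbol{\phi}^\prime}{\partial \boldsymbol{u}_{s}^*}$, $s=\underline{t},\dots,\bar{t}$ (not to be confused with the number $N$ of segments); - $\boldsymbol{V}\in\mathbb{R}^{nL\times n}$: zero except for its last $n\times n$ block, which equals $\frac{\partial \boldsymbol{f}^\prime}{\partial \boldsymbol{x}_{\bar{t}}^*}$. Set $\boldsymbol{F}(\boldsymbol{\xi}_{\underline{t}:\bar{t}})=\boldsymbol{B}\boldsymbol{A}^{-1}\boldsymbol{M}+\boldsymbol{N}\in\mathbb{R}^{mL\times r}$ and $\boldsymbol{E}(\boldsymbol{\xi}_{\underline{t}:\bar{t}})=\boldsymbol{B}\boldsymbol{A}^{-1}\boldsymbol{V}\in\mathbb{R}^{mL\times n}$. Data effectiveness. The segment $\boldsymbol{\xi}_{\underline{t}:\bar{t}}$ is called data effective if $\operatorname{rank}\boldsymbol{E}(\boldsymbol{\xi}_{\underline{t}:\bar{t}})=n$.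 For a data effective segment define $$\boldsymbol{R}(\boldsymbol{\xi}_{\underline{t}:\bar{t}})=\boldsymbol{F}-\boldsymbol{E}(\boldsymbol{E}^\prime\boldsymbol{E})^{-1}\boldsymbol{E}^\prime\boldsymbol{F}\in\mathbb{R}^{mL\times r},$$ where $\boldsymbol{F}=\boldsymbol{F}(\boldsymbol{\xi}_{\underline{t}:\bar{t}})$ and $\boldsymbol{E}=\boldsymbol{E}(\boldsymbol{\xi}_{\underline{t}:\bar{t}})$. *)

theory Defs
  imports
    "HOL-Analysis.Analysis"
    "HOL-Library.Extended_Nat"
    "Jordan_Normal_Form.Gauss_Jordan_Elimination"
    "Jordan_Normal_Form.DL_Rank"
begin

text \<open>
  The dynamics and the features are maps between Euclidean spaces \<^typ>\<open>real ^ 'n\<close>, so that the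
  library's derivatives apply.  The matrices of a segment have sizes that depend on the length of
  the segment and are therefore values of type \<^typ>\<open>real mat\<close>.  Coordinates are numbered
  \<open>0, 1, \<dots>\<close> in the linear order of the finite index type.
\<close>

definition coord :: "nat \<Rightarrow> 'a::{finite,linorder}" where
  "coord i = sorted_list_of_set (UNIV :: 'a set) ! i"

definition mat_of_cart :: "real ^ 'b::{finite,linorder} ^ 'a::{finite,linorder} \<Rightarrow> real mat" where
  "mat_of_cart J = Matrix.mat CARD('a) CARD('b)
     (\<lambda>(i, j). vec_nth (vec_nth J (coord i)) (coord j))"

text \<open>The transposed Jacobians.  A trajectory is a pair of functions \<open>x\<close>, \<open>u\<close> of the time index;
  \<open>x 0\<close> is the initial state.  For a finite horizon \<open>T\<close> the value \<open>u (T + 1)\<close> is the arbitrary fixed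
  vector that replaces the missing input.  The trajectory is data: it may be noisy or sub-optimal, so
  neither the dynamics nor optimality is imposed on it.  (If it were exactly optimal, the true weight
  vector would lie in the kernel of every \<open>seg_R\<close> below and \<open>W_mat\<close> would be singular.)\<close>

definition state_jac ::
  "((real ^ 'n::{finite,linorder}) \<times> (real ^ 'm::{finite,linorder}) \<Rightarrow> (real ^ 'n::{finite,linorder})) \<Rightarrow>
   (nat \<Rightarrow> (real ^ 'n::{finite,linorder})) \<Rightarrow> (nat \<Rightarrow> (real ^ 'm::{finite,linorder})) \<Rightarrow>
   nat \<Rightarrow> real mat" where
  "state_jac f x u s =
     transpose_mat (mat_of_cart (jacobian (\<lambda>y. f (y, u (s + 1))) (at (x s))))"

definition input_jac ::
  "((real ^ 'n::{finite,linorder}) \<times> (real ^ 'm::{finite,linorder}) \<Rightarrow> (real ^ 'n::{finite,linorder})) \<Rightarrow>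
   (nat \<Rightarrow> (real ^ 'n::{finite,linorder})) \<Rightarrow> (nat \<Rightarrow> (real ^ 'm::{finite,linorder})) \<Rightarrow>
   nat \<Rightarrow> real mat" where
  "input_jac f x u s =
     transpose_mat (mat_of_cart (jacobian (\<lambda>v. f (x (s - 1), v)) (at (u s))))"

definition feature_state_jac ::
  "((real ^ 'n::{finite,linorder}) \<times> (real ^ 'm::{finite,linorder}) \<Rightarrow> (real ^ 'r::{finite,linorder})) \<Rightarrow>
   (nat \<Rightarrow> (real ^ 'n::{finite,linorder})) \<Rightarrow> (nat \<Rightarrow> (real ^ 'm::{finite,linorder})) \<Rightarrow>
   nat \<Rightarrow> real mat" where
  "feature_state_jac \<phi> x u s =
     transpose_mat (mat_of_cart (jacobian (\<lambda>y. \<phi> (y, u s)) (at (x s))))"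

definition feature_input_jac ::
  "((real ^ 'n::{finite,linorder}) \<times> (real ^ 'm::{finite,linorder}) \<Rightarrow> (real ^ 'r::{finite,linorder})) \<Rightarrow>
   (nat \<Rightarrow> (real ^ 'n::{finite,linorder})) \<Rightarrow> (nat \<Rightarrow> (real ^ 'm::{finite,linorder})) \<Rightarrow>
   nat \<Rightarrow> real mat" where
  "feature_input_jac \<phi> x u s =
     transpose_mat (mat_of_cart (jacobian (\<lambda>v. \<phi> (x s, v)) (at (u s))))"

text \<open>A segment is given by its first and last time index \<open>(a, b)\<close>.\<close>

definition is_segment :: "enat \<Rightarrow> nat \<times> nat \<Rightarrow> bool" where
  "is_segment T seg \<longleftrightarrow> 1 \<le> fst seg \<and> fst seg \<le> snd seg \<and> enat (snd seg) \<le> T"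

definition seg_length :: "nat \<times> nat \<Rightarrow> nat" where
  "seg_length seg = snd seg + 1 - fst seg"

definition seg_times :: "nat \<times> nat \<Rightarrow> nat list" where
  "seg_times seg = [fst seg ..< snd seg + 1]"

text \<open>The column count \<open>nc\<close> only matters for the empty stack.\<close>

definition vstack :: "nat \<Rightarrow> real mat list \<Rightarrow> real mat" where
  "vstack nc Ms = foldr (@\<^sub>r) Ms (0\<^sub>m 0 nc)"

text \<open>Meaningful for invertible arguments only; then \<^const>\<open>mat_inverse\<close> returns the inverse.\<close>

definition inv_mat :: "real mat \<Rightarrow> real mat" where
  "inv_mat A = the (mat_inverse A)"

context
  fixes f :: "(real ^ 'n::{finite,linorder}) \<times> (real ^ 'm::{finite,linorder}) \<Rightarrow>
      (real ^ 'n::{finite,linorder})"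
    and x :: "nat \<Rightarrow> (real ^ 'n::{finite,linorder})"
    and u :: "nat \<Rightarrow> (real ^ 'm::{finite,linorder})"
begin

text \<open>Entry \<open>(i, j)\<close> of \<open>A\<close> lies in block \<open>(i div n, j div n)\<close>, at position \<open>(i mod n, j mod n)\<close>.\<close>

definition seg_A :: "nat \<times> nat \<Rightarrow> real mat" where
  "seg_A seg = (let n = CARD('n); L = seg_length seg in
     Matrix.mat (n * L) (n * L) (\<lambda>(i, j).
       if j div n = i div n then 1\<^sub>m n $$ (i mod n, j mod n)
       else if j div n = i div n + 1
         then (- state_jac f x u (fst seg + i div n)) $$ (i mod n, j mod n)
       else 0))"

definition seg_B :: "nat \<times> nat \<Rightarrow> real mat" where
  "seg_B seg = diag_block_mat (map (input_jac f x u) (seg_times seg))"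

definition seg_V :: "nat \<times> nat \<Rightarrow> real mat" where
  "seg_V seg = 0\<^sub>m (CARD('n) * (seg_length seg - 1)) CARD('n) @\<^sub>r state_jac f x u (snd seg)"

definition seg_E :: "nat \<times> nat \<Rightarrow> real mat" where
  "seg_E seg = seg_B seg * inv_mat (seg_A seg) * seg_V seg"

definition data_effective :: "nat \<times> nat \<Rightarrow> bool" where
  "data_effective seg \<longleftrightarrow> vec_space.rank (dim_row (seg_E seg)) (seg_E seg) = CARD('n)"

context
  fixes \<phi> :: "(real ^ 'n::{finite,linorder}) \<times> (real ^ 'm::{finite,linorder}) \<Rightarrow> (real ^ 'r::{finite,linorder})"
begin

definition seg_M :: "nat \<times> nat \<Rightarrow> real mat" where
  "seg_M seg = vstack CARD('r) (map (feature_state_jac \<phi> x u) (seg_times seg))"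

definition seg_N :: "nat \<times> nat \<Rightarrow> real mat" where
  "seg_N seg = vstack CARD('r) (map (feature_input_jac \<phi> x u) (seg_times seg))"

definition seg_F :: "nat \<times> nat \<Rightarrow> real mat" where
  "seg_F seg = seg_B seg * inv_mat (seg_A seg) * seg_M seg + seg_N seg"

definition seg_R :: "nat \<times> nat \<Rightarrow> real mat" where
  "seg_R seg = (let E = seg_E seg; F = seg_F seg in
     F - E * inv_mat (transpose_mat E * E) * transpose_mat E * F)"

text \<open>In the following two definitions \<open>segs i\<close> is the \<open>i\<close>-th segment, for \<open>i = 1, \<dots>, N\<close>.\<close>

fun W_mat :: "(nat \<Rightarrow> nat \<times> nat) \<Rightarrow> nat \<Rightarrow> real mat" where
  "W_mat segs 0 = 0\<^sub>m CARD('r) CARD('r)"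
| "W_mat segs (Suc i) =
     (if data_effective (segs (Suc i))
      then W_mat segs i + transpose_mat (seg_R (segs (Suc i))) * seg_R (segs (Suc i))
      else W_mat segs i + 0\<^sub>m CARD('r) CARD('r))"

definition R_stack :: "(nat \<Rightarrow> nat \<times> nat) \<Rightarrow> nat \<Rightarrow> real mat" where
  "R_stack segs N =
     vstack CARD('r) (map seg_R (filter data_effective (map segs [1..<N + 1])))"

end

end

definition l2_norm_vec :: "real vec \<Rightarrow> real" where
  "l2_norm_vec v = L2_set (vec_index v) {..<dim_vec v}"

end

theory Submission
  imports Defs
begin

text \<open>The Gram matrix \<open>R\<^sup>T R\<close> of the stacked matrix \<open>R\<close> is \<open>W\<close>, so \<open>W\<close> is positive definite once it is
  invertible.  The point \<open>q\<close>, the multiple of \<open>W\<^sup>-\<^sup>1 e\<^sub>1\<close> that satisfies the constraint, has \<open>W q\<close>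
  proportional to \<open>e\<^sub>1\<close>.  Hence for feasible \<open>w\<close> the vectors \<open>R q\<close> and \<open>R (w - q)\<close> are orthogonal, and
  Pythagoras makes \<open>q\<close> the unique minimiser.\<close>

context
  includes no inner_syntax
begin

text \<open>Links two notions of invertibility: \<open>mat_inverse\<close> returns
  \<open>None\<close> only outside the units of the matrix ring, and \<open>invertible_mat\<close>
  supplies the witness that \<open>A\<close> is such a unit.\<close>

lemma inv_mat_inverse:
  assumes A: "A \<in> carrier_mat n n" and "invertible_mat A"
  shows "inv_mat A \<in> carrier_mat n n" and "A * inv_mat A = 1\<^sub>m n" and "inv_mat A * A = 1\<^sub>m n"
proof -
  obtain B where B: "A * B = 1\<^sub>m n" "B * A = 1\<^sub>m (dim_row B)"
    using assms unfolding invertible_mat_def inverts_mat_def by auto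
  \<comment> \<open>The size of \<open>B\<close> is left open by \<open>invertible_mat\<close>; the
    column counts of the two products force it to be square of order \<open>n\<close>.\<close>
  have "dim_col (A * B) = n" "dim_col (B * A) = dim_row B"
    using B by simp_all
  then have "B \<in> carrier_mat n n"
    using A by auto
  then have "A \<in> Units (ring_mat TYPE(real) n ())"
    using A B unfolding Units_def ring_mat_def by auto
  then obtain C where "mat_inverse A = Some C"
    using mat_inverse(1)[OF A, where b = "()"] by (cases "mat_inverse A") auto
  then show "inv_mat A \<in> carrier_mat n n" and "A * inv_mat A = 1\<^sub>m n" and "inv_mat A * A = 1\<^sub>m n"
    using mat_inverse(2)[OF A] unfolding inv_mat_def by auto
qed

lemma l2_norm_vec_power2: "(l2_norm_vec v)\<^sup>2 = v \<bullet> v"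
  unfolding l2_norm_vec_def L2_set_def scalar_prod_def
  by (simp add: sum_nonneg power2_eq_square lessThan_atLeast0)

lemma scalar_prod_self_nonneg: "0 \<le> v \<bullet> v" for v :: "real vec"
  by (simp add: scalar_prod_def sum_nonneg)

lemma scalar_prod_self_eq_0:
  fixes v :: "real vec"
  assumes "v \<bullet> v = 0"
  shows "v = 0\<^sub>v (dim_vec v)"
  using assms by (intro eq_vecI) (auto simp: scalar_prod_def sum_nonneg_eq_0_iff)

text \<open>Each column of the stack is the concatenation of a column of \<open>A\<close> and one of
  \<open>B\<close>, so the scalar products of columns split.\<close>

lemma gram_append_rows:
  fixes A B :: "real mat"
  assumes "A \<in> carrier_mat k n" and "B \<in> carrier_mat l n"
  shows "transpose_mat (A @\<^sub>r B) * (A @\<^sub>r B) = transpose_mat A * A + transpose_mat B * B"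
proof -
  have col: "col (A @\<^sub>r B) i = col A i @\<^sub>v col B i" if "i < n" for i
    using assms that by (intro eq_vecI) (auto simp: append_rows_def)
  have "A @\<^sub>r B \<in> carrier_mat (k + l) n"
    using assms by simp
  then have "dim_col (A @\<^sub>r B) = n" by simp
  then show ?thesis
    using assms
    by (intro eq_matI) (auto simp: col scalar_prod_append[of _ k _ l])
qed

lemma vstack_Cons: "vstack n (M # Ms) = M @\<^sub>r vstack n Ms"
  by (simp add: vstack_def)

lemma vstack_carrier:
  assumes "\<And>M. M \<in> set Ms \<Longrightarrow> dim_col M = n"
  shows "vstack n Ms \<in> carrier_mat (sum_list (map dim_row Ms)) n"
  using assms
proof (induction Ms)
  case Nil
  then show ?case by (simp add: vstack_def)
next
  case (Cons M Ms)
  have "M \<in> carrier_mat (dim_row M) n"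
    using Cons.prems by auto
  from carrier_append_rows[OF this Cons.IH] show ?case
    using Cons.prems by (simp add: vstack_Cons)
qed

text \<open>\<open>W_mat\<close> adds the newest segment last, whereas \<open>vstack\<close> folds
  from the right; this form matches the recursion of \<open>W_mat\<close>.\<close>

lemma gram_vstack_snoc:
  assumes "\<forall>M' \<in> set Ms. dim_col M' = n" and "dim_col M = n"
  shows "transpose_mat (vstack n (Ms @ [M])) * vstack n (Ms @ [M])
    = transpose_mat (vstack n Ms) * vstack n Ms + transpose_mat M * M"
  using assms
proof (induction Ms)
  case Nil
  obtain k where M: "M \<in> carrier_mat k n"
    using Nil by blast
  then have "transpose_mat M * M \<in> carrier_mat n n"
    by auto
  \<comment> \<open>The stack of one matrix still ends in the empty block with \<open>0\<close> rows
    and \<open>n\<close> columns, whose Gram matrix is zero.\<close>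
  then show ?case
    using gram_append_rows[OF M zero_carrier_mat[of 0 n]] by (simp add: vstack_def)
next
  case (Cons M' Ms)
  let ?V = "vstack n Ms" and ?V' = "vstack n (Ms @ [M])"
  obtain k where M': "M' \<in> carrier_mat k n"
    using Cons.prems by fastforce
  obtain l where V: "?V \<in> carrier_mat l n"
    using vstack_carrier[of Ms n] Cons.prems by auto
  obtain l' where V': "?V' \<in> carrier_mat l' n"
    using vstack_carrier[of "Ms @ [M]" n] Cons.prems by auto
  have IH: "transpose_mat ?V' * ?V' = transpose_mat ?V * ?V + transpose_mat M * M"
    using Cons by auto
  have "transpose_mat M' * M' \<in> carrier_mat n n" "transpose_mat ?V * ?V \<in> carrier_mat n n"
    "transpose_mat M * M \<in> carrier_mat n n"
    using M' V Cons.prems by auto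
  from assoc_add_mat[OF this] show ?case
    unfolding append_Cons vstack_Cons gram_append_rows[OF M' V] gram_append_rows[OF M' V'] IH
    by simp
qed

text \<open>The dimensions of a matrix sum or difference are those of its last operand, so the column count
  is that of \<^const>\<open>seg_N\<close>.\<close>

lemma dim_col_seg_R [simp]:
  fixes \<phi> :: "(real ^ 'n::{finite,linorder}) \<times> (real ^ 'm::{finite,linorder}) \<Rightarrow>
      (real ^ 'r::{finite,linorder})"
  shows "dim_col (seg_R f x u \<phi> seg) = CARD('r)"
proof -
  have "seg_N x u \<phi> seg \<in> carrier_mat
      (sum_list (map dim_row (map (feature_input_jac \<phi> x u) (seg_times seg)))) CARD('r)"
    unfolding seg_N_def
    by (rule vstack_carrier) (auto simp: feature_input_jac_def mat_of_cart_def)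
  then show ?thesis
    by (simp add: seg_R_def seg_F_def Let_def)
qed

lemma dim_col_R_stack [simp]:
  fixes \<phi> :: "(real ^ 'n::{finite,linorder}) \<times> (real ^ 'm::{finite,linorder}) \<Rightarrow>
      (real ^ 'r::{finite,linorder})"
  shows "dim_col (R_stack f x u \<phi> segs N) = CARD('r)"
  unfolding R_stack_def by (rule carrier_matD(2)[OF vstack_carrier]) auto

text \<open>An ineffective segment is a zero summand on the left and is filtered out on the right;
  an effective one becomes the last block of the stack.\<close>

lemma W_mat_eq_gram:
  fixes \<phi> :: "(real ^ 'n::{finite,linorder}) \<times> (real ^ 'm::{finite,linorder}) \<Rightarrow>
      (real ^ 'r::{finite,linorder})"
  shows "W_mat f x u \<phi> segs N
    = transpose_mat (R_stack f x u \<phi> segs N) * R_stack f x u \<phi> segs N"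
proof (induction N)
  case 0
  then show ?case
    by (intro eq_matI) (auto simp: R_stack_def vstack_def scalar_prod_def)
next
  case (Suc N)
  \<comment> \<open>The size is needed for the zero matrix added in the ineffective case to be
    neutral.\<close>
  have "W_mat f x u \<phi> segs N \<in> carrier_mat CARD('r) CARD('r)"
    unfolding Suc by auto
  moreover have "[1..<Suc N + 1] = [1..<N + 1] @ [Suc N]"
    by simp
  ultimately show ?case
    using Suc by (auto simp: R_stack_def gram_vstack_snoc simp del: upt_Suc)
qed

text \<open>Treats any nonzero constraint vector \<open>c\<close>. Equality with a singleton gives
  existence and uniqueness of the minimiser at once.\<close>

lemma arg_min_least_squares:
  fixes R :: "real mat" and c :: "real vec"
  defines "W \<equiv> transpose_mat R * R"
  defines "p \<equiv> inv_mat W *\<^sub>v c"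
  assumes R: "R \<in> carrier_mat k n"
    and c: "c \<in> carrier_vec n" "c \<noteq> 0\<^sub>v n"
    and inv: "invertible_mat W"
  shows "{\<omega>. is_arg_min (\<lambda>\<omega>. 1 / 2 * (l2_norm_vec (R *\<^sub>v \<omega>))\<^sup>2)
               (\<lambda>\<omega>. \<omega> \<in> carrier_vec n \<and> c \<bullet> \<omega> = 1) \<omega>}
       = {(1 / (c \<bullet> p)) \<cdot>\<^sub>v p}"
proof -
  have W: "W \<in> carrier_mat n n"
    unfolding W_def using R by auto
  note P = inv_mat_inverse[OF W inv]
  have p: "p \<in> carrier_vec n"
    unfolding p_def using P(1) c(1) by auto
  have Wp: "W *\<^sub>v p = c"
    unfolding p_def using P c(1) W by (simp flip: assoc_mult_mat_vec)
  \<comment> \<open>Moves one factor \<open>R\<close> across the scalar product; it serves both the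
    sign of \<open>c \<bullet> p\<close> and the orthogonality.\<close>
  have form: "(R *\<^sub>v v) \<bullet> (R *\<^sub>v w) = v \<bullet> (W *\<^sub>v w)"
    if "v \<in> carrier_vec n" "w \<in> carrier_vec n" for v w
  proof -
    have "W *\<^sub>v w = transpose_mat R *\<^sub>v (R *\<^sub>v w)"
      unfolding W_def using R that by (intro assoc_mult_mat_vec) auto
    moreover have "(transpose_mat R *\<^sub>v (R *\<^sub>v w)) \<bullet> v = (R *\<^sub>v w) \<bullet> (R *\<^sub>v v)"
      using R that by (intro transpose_vec_mult_scalar) auto
    ultimately show ?thesis
      using R that
      by (metis comm_scalar_prod mult_mat_vec_carrier transpose_carrier_mat)
  qed
  \<comment> \<open>Definiteness: a zero image under \<open>R\<close> gives
    \<open>W *\<^sub>v v = 0\<^sub>v n\<close>, and applying the inverse of \<open>W\<close>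
    recovers \<open>v\<close>.\<close>
  have kernel: "v = 0\<^sub>v n" if v: "v \<in> carrier_vec n" and "(R *\<^sub>v v) \<bullet> (R *\<^sub>v v) = 0" for v
  proof -
    have "R *\<^sub>v v = 0\<^sub>v k"
      using scalar_prod_self_eq_0[OF that(2)] R by simp
    then have "W *\<^sub>v v = 0\<^sub>v n"
      unfolding W_def using R v by (subst assoc_mult_mat_vec[of _ n k _ n]) auto
    moreover have "v = inv_mat W *\<^sub>v (W *\<^sub>v v)"
      using P(1,3) W v by (simp flip: assoc_mult_mat_vec)
    ultimately show ?thesis
      using P(1) by (auto intro!: eq_vecI)
  qed
  let ?sq = "\<lambda>v. (R *\<^sub>v v) \<bullet> (R *\<^sub>v v)"
  define q where "q = (1 / (c \<bullet> p)) \<cdot>\<^sub>v p"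
  \<comment> \<open>The normalising factor must not divide by zero: \<open>c \<bullet> p\<close> is
    the squared norm of the image of \<open>p\<close>, which vanishes only for \<open>p\<close>
    zero.\<close>
  have "p \<noteq> 0\<^sub>v n"
    using Wp W c(2) by auto
  moreover have "?sq p = c \<bullet> p"
    using form[OF p p] Wp comm_scalar_prod[OF p c(1)] by simp
  ultimately have cp: "c \<bullet> p \<noteq> 0"
    using kernel[OF p] by metis
  have q: "q \<in> carrier_vec n" and cq: "c \<bullet> q = 1"
    using p c(1) cp by (auto simp: q_def)
  have Wq: "W *\<^sub>v q = (1 / (c \<bullet> p)) \<cdot>\<^sub>v c"
    using mult_mat_vec[OF W p] Wp by (simp add: q_def)
  have pythagoras: "?sq w = ?sq q + ?sq (w - q)"
    if w: "w \<in> carrier_vec n" "c \<bullet> w = 1" for w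
  proof -
    have d: "w - q \<in> carrier_vec n"
      using w q by auto
    have "c \<bullet> (w - q) = 0"
      using w q c(1) cq by (simp add: scalar_prod_minus_distrib[of _ n])
    then have "(w - q) \<bullet> c = 0"
      using comm_scalar_prod[OF d c(1)] by simp
    \<comment> \<open>By \<open>form\<close> the product is that of \<open>w - q\<close> with
      \<open>W *\<^sub>v q\<close>, a multiple of \<open>c\<close>.\<close>
    then have orth: "(R *\<^sub>v (w - q)) \<bullet> (R *\<^sub>v q) = 0"
      using form[OF d q] Wq d c(1) by simp
    have Rd: "R *\<^sub>v (w - q) \<in> carrier_vec k" and Rq: "R *\<^sub>v q \<in> carrier_vec k"
      using R d q by auto
    have "w = q + (w - q)"
      using w q by auto
    then have "R *\<^sub>v w = R *\<^sub>v q + R *\<^sub>v (w - q)"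
      using mult_add_distrib_mat_vec[OF R q d] by simp
    then show ?thesis
      using Rd Rq orth comm_scalar_prod[OF Rq Rd]
      by (simp add: scalar_prod_add_distrib[of _ k] add_scalar_prod_distrib[of _ k])
  qed
  have minimal: "?sq q \<le> ?sq w" if "w \<in> carrier_vec n" "c \<bullet> w = 1" for w
    using pythagoras[OF that] scalar_prod_self_nonneg[of "R *\<^sub>v (w - q)"] by simp
  have unique: "w = q" if w: "w \<in> carrier_vec n" "c \<bullet> w = 1" and "?sq w \<le> ?sq q" for w
  proof -
    \<comment> \<open>If \<open>w\<close> does no worse than \<open>q\<close>, Pythagoras leaves no
      room for the nonnegative extra term.\<close>
    have "?sq (w - q) = 0"
      using pythagoras[OF w] that(3) scalar_prod_self_nonneg[of "R *\<^sub>v (w - q)"] by simp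
    then have "w - q = 0\<^sub>v n"
      using kernel w q by simp
    then have "w $ i - q $ i = 0" if "i < n" for i
      using that q by (simp flip: index_minus_vec(1))
    then show ?thesis
      using w(1) q by (intro eq_vecI) auto
  qed
  show ?thesis
    unfolding p_def[symmetric] q_def[symmetric] is_arg_min_def l2_norm_vec_power2
  proof (intro equalityI subsetI)
    fix w
    assume "w \<in> {w. (w \<in> carrier_vec n \<and> c \<bullet> w = 1)
      \<and> (\<nexists>y. (y \<in> carrier_vec n \<and> c \<bullet> y = 1) \<and> 1 / 2 * ?sq y < 1 / 2 * ?sq w)}"
    \<comment> \<open>The minimality of \<open>w\<close> is tested against the single competitor
      \<open>q\<close>.\<close>
    then have "w \<in> carrier_vec n" "c \<bullet> w = 1" and "\<not> 1 / 2 * ?sq q < 1 / 2 * ?sq w"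
      using q cq by blast+
    then show "w \<in> {q}"
      using unique by simp
  next
    fix w
    assume "w \<in> {q}"
    moreover have "\<not> 1 / 2 * ?sq y < 1 / 2 * ?sq q"
      if "y \<in> carrier_vec n" "c \<bullet> y = 1" for y
      using minimal[OF that] by simp
    ultimately show "w \<in> {w. (w \<in> carrier_vec n \<and> c \<bullet> w = 1)
      \<and> (\<nexists>y. (y \<in> carrier_vec n \<and> c \<bullet> y = 1) \<and> 1 / 2 * ?sq y < 1 / 2 * ?sq w)}"
      using q cq by blast
  qed
qed

end

theorem lemma2:
  fixes f :: "(real ^ 'n::{finite,linorder}) \<times> (real ^ 'm::{finite,linorder}) \<Rightarrow>
      (real ^ 'n::{finite,linorder})"
    and \<phi> :: "(real ^ 'n::{finite,linorder}) \<times> (real ^ 'm::{finite,linorder}) \<Rightarrow>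
      (real ^ 'r::{finite,linorder})"
    and x :: "nat \<Rightarrow> (real ^ 'n::{finite,linorder})"
    and u :: "nat \<Rightarrow> (real ^ 'm::{finite,linorder})"
    and T :: enat
    and t N :: nat
    and segs :: "nat \<Rightarrow> nat \<times> nat"
    and W :: "nat \<Rightarrow> real mat"
    and e\<^sub>1 :: "real vec"
  assumes "\<And>z. f differentiable (at z)"
    and "\<And>z. \<phi> differentiable (at z)"
    and "\<And>i. i \<in> {1..N} \<Longrightarrow> is_segment T (segs i)"
    and "\<And>i. i \<in> {1..N} \<Longrightarrow> snd (segs i) \<le> t"
    and "W = W_mat f x u \<phi> segs"
    and "e\<^sub>1 = unit_vec CARD('r) 0"
    and "invertible_mat (W N)"
  shows "{\<omega>. is_arg_min
               (\<lambda>\<omega>. 1 / 2 * (l2_norm_vec (R_stack f x u \<phi> segs N *\<^sub>v \<omega>))\<^sup>2)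
               (\<lambda>\<omega>. \<omega> \<in> carrier_vec CARD('r) \<and> e\<^sub>1 \<bullet> \<omega> = 1) \<omega>}
       = {(1 / (e\<^sub>1 \<bullet> (inv_mat (W N) *\<^sub>v e\<^sub>1))) \<cdot>\<^sub>v (inv_mat (W N) *\<^sub>v e\<^sub>1)}"
proof -
  have "R_stack f x u \<phi> segs N \<in> carrier_mat (dim_row (R_stack f x u \<phi> segs N)) CARD('r)"
    by auto
  \<comment> \<open>The vector \<open>e\<^sub>1\<close> is nonzero because \<open>CARD('r)\<close>
    is positive, so index \<open>0\<close> is in range.\<close>
  from arg_min_least_squares[OF this, of e\<^sub>1] show ?thesis
    using assms(5-7) by (simp add: W_mat_eq_gram)
qed

end
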